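(* Let $X$ be an $L$-algebra. The lattice $\mathcal{I}(X)$ of ideals of $X$ is distributive; that is, $(I\vee J)\cap K=(I\cap K)\vee(J\cap K)$ for all ideals $I,J,K$ of $X$.
   Context: An $L$-algebra is a set $X$ with a binary operation $(x,y)\mapsto x\cdot y$ and an element $1\in X$ such that for all $x,y,z\in X$: (i) $x\cdot x=x\cdot 1=1$ and $1\cdot x=x$; (ii) $(x\cdot y)\cdot(x\cdot z)=(y\cdot x)\cdot(y\cdot z)$; (iii) $x\cdot y=y\cdot x=1$ implies $x=y$. An ideal of $X$ is a subset $I\subseteq X$ with $1\in I$ such that for all $x,y\in X$: if $x\in I$ and $x\cdot y\in I$, then $y\in I$; if $x\in I$, then $(x\cdot y)\cdot y\in I$; if $x\in I$, then $y\cdot x\in I$ and $y\cdot(x\cdot y)\in I$. $\mathcal{I}(X)$ denotes the set of all ideals of $X$, partially ordered by inclusion. It is closed under arbitrary intersections, hence is a complete lattice with meet given by intersection; $I\vee J$ denotes the join of $I$ and $J$ in $\mathcal{I}(X)$, i.e. the smallest ideal containing $I\cup J$. *)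

theory Defs
  imports Main
begin

locale L_algebra =
  fixes X :: "'a set"
    and mult :: "'a \<Rightarrow> 'a \<Rightarrow> 'a"  (infixl \<open>\<cdot>\<close> 70)
    and unit :: "'a"  (\<open>\<one>\<close>)
  assumes mult_closed: "x \<in> X \<Longrightarrow> y \<in> X \<Longrightarrow> x \<cdot> y \<in> X"
    and unit_closed: "\<one> \<in> X"
    and mult_self: "x \<in> X \<Longrightarrow> x \<cdot> x = \<one>"
    and mult_unit: "x \<in> X \<Longrightarrow> x \<cdot> \<one> = \<one>"
    and unit_mult: "x \<in> X \<Longrightarrow> \<one> \<cdot> x = x"
    and cycloid: "x \<in> X \<Longrightarrow> y \<in> X \<Longrightarrow> z \<in> X \<Longrightarrow>
      (x \<cdot> y) \<cdot> (x \<cdot> z) = (y \<cdot> x) \<cdot> (y \<cdot> z)"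
    and antisym: "x \<in> X \<Longrightarrow> y \<in> X \<Longrightarrow> x \<cdot> y = \<one> \<Longrightarrow> y \<cdot> x = \<one> \<Longrightarrow> x = y"
begin

definition L_ideal :: "'a set \<Rightarrow> bool" where
  "L_ideal I \<longleftrightarrow>
     I \<subseteq> X \<and> \<one> \<in> I \<and>
     (\<forall>x\<in>X. \<forall>y\<in>X.
        (x \<in> I \<and> x \<cdot> y \<in> I \<longrightarrow> y \<in> I) \<and>
        (x \<in> I \<longrightarrow> (x \<cdot> y) \<cdot> y \<in> I) \<and>
        (x \<in> I \<longrightarrow> y \<cdot> x \<in> I \<and> y \<cdot> (x \<cdot> y) \<in> I))"

definition ideals :: "'a set set" where
  "ideals = {I. L_ideal I}"

definition ideal_join :: "'a set \<Rightarrow> 'a set \<Rightarrow> 'a set" where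
  "ideal_join I J = \<Inter> {K \<in> ideals. I \<union> J \<subseteq> K}"

lemma carrier_in_ideals: "X \<in> ideals"
  by (simp add: ideals_def L_ideal_def mult_closed unit_closed)

lemma Inter_in_ideals: "\<A> \<noteq> {} \<Longrightarrow> \<A> \<subseteq> ideals \<Longrightarrow> \<Inter> \<A> \<in> ideals"
  unfolding ideals_def L_ideal_def by blast

(* the intersection defining ideal_join is the smallest ideal containing both arguments *)
lemma ideal_join_least:
  assumes "I \<in> ideals" and "J \<in> ideals"
  shows "ideal_join I J \<in> ideals"
    and "I \<union> J \<subseteq> ideal_join I J"
    and "K \<in> ideals \<Longrightarrow> I \<union> J \<subseteq> K \<Longrightarrow> ideal_join I J \<subseteq> K"
proof -
  have "I \<union> J \<subseteq> X"
    using assms by (auto simp: ideals_def L_ideal_def)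
  then show "ideal_join I J \<in> ideals"
    unfolding ideal_join_def using carrier_in_ideals by (intro Inter_in_ideals) auto
  show "I \<union> J \<subseteq> ideal_join I J"
    unfolding ideal_join_def by blast
  show "K \<in> ideals \<Longrightarrow> I \<union> J \<subseteq> K \<Longrightarrow> ideal_join I J \<subseteq> K"
    unfolding ideal_join_def by blast
qed

end

end

theory Submission
  imports Defs
begin

(* An ideal I induces the congruence x ~ y iff x . y and y . x lie in I, and the join of I and J is
   the ~-saturation of J.  The delicate point is closure of the saturation under modus ponens: if
   j ~ x and k ~ x . y with j, k in J, then a = k . (j . y) lies in I and is congruent to y modulo J,
   so a . y lies in J, which puts y in the saturation.  Hence an element x of the join has some j
   in J with j . x in I, and then (j . x) . x lies in J.  If moreover x is in K, both of these lie
   in K as well, and modus ponens gives x in the join of the intersections. *)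

context L_algebra
begin

text \<open>Membership in \<open>X\<close> is built in, so that saturations under the relation stay
  inside the carrier.\<close>

definition ideal_cong :: "'a set \<Rightarrow> 'a \<Rightarrow> 'a \<Rightarrow> bool" where
  "ideal_cong I x y \<longleftrightarrow> x \<in> X \<and> y \<in> X \<and> x \<cdot> y \<in> I \<and> y \<cdot> x \<in> I"

lemma ideal_subset: "I \<in> ideals \<Longrightarrow> x \<in> I \<Longrightarrow> x \<in> X"
  by (auto simp: ideals_def L_ideal_def)

lemma ideal_unit: "I \<in> ideals \<Longrightarrow> \<one> \<in> I"
  by (auto simp: ideals_def L_ideal_def)

lemma ideal_mp: "I \<in> ideals \<Longrightarrow> x \<in> I \<Longrightarrow> y \<in> X \<Longrightarrow> x \<cdot> y \<in> I \<Longrightarrow> y \<in> I"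
  unfolding ideals_def L_ideal_def by blast

lemma ideal_double: "I \<in> ideals \<Longrightarrow> x \<in> I \<Longrightarrow> y \<in> X \<Longrightarrow> (x \<cdot> y) \<cdot> y \<in> I"
  unfolding ideals_def L_ideal_def by blast

lemma ideal_mult: "I \<in> ideals \<Longrightarrow> x \<in> I \<Longrightarrow> y \<in> X \<Longrightarrow> y \<cdot> x \<in> I"
  unfolding ideals_def L_ideal_def by blast

lemma ideal_weaken: "I \<in> ideals \<Longrightarrow> x \<in> I \<Longrightarrow> y \<in> X \<Longrightarrow> y \<cdot> (x \<cdot> y) \<in> I"
  unfolding ideals_def L_ideal_def by blast

lemma idealsI:
  assumes "I \<subseteq> X" "\<one> \<in> I"
    and "\<And>x y. y \<in> X \<Longrightarrow> x \<in> I \<Longrightarrow> x \<cdot> y \<in> I \<Longrightarrow> y \<in> I"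
    and "\<And>x y. y \<in> X \<Longrightarrow> x \<in> I \<Longrightarrow> (x \<cdot> y) \<cdot> y \<in> I \<and> y \<cdot> x \<in> I \<and> y \<cdot> (x \<cdot> y) \<in> I"
  shows "I \<in> ideals"
  unfolding ideals_def L_ideal_def using assms by blast

lemma ideal_cong_refl: "I \<in> ideals \<Longrightarrow> x \<in> X \<Longrightarrow> ideal_cong I x x"
  by (simp add: ideal_cong_def mult_self ideal_unit)

lemma ideal_cong_sym: "ideal_cong I x y \<Longrightarrow> ideal_cong I y x"
  by (simp add: ideal_cong_def)

text \<open>An ideal absorbs multiplication from the left, so it contains
  \<open>(y \<cdot> x) \<cdot> (y \<cdot> z)\<close>; \<open>cycloid\<close> turns this into
  \<open>(x \<cdot> y) \<cdot> (x \<cdot> z)\<close>, and modus ponens removes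
  \<open>x \<cdot> y\<close>.\<close>

lemma ideal_mult_trans:
  assumes I: "I \<in> ideals" and X: "x \<in> X" "y \<in> X" "z \<in> X" and "x \<cdot> y \<in> I" "y \<cdot> z \<in> I"
  shows "x \<cdot> z \<in> I"
proof -
  have "(y \<cdot> x) \<cdot> (y \<cdot> z) \<in> I"
    using assms by (simp add: ideal_mult mult_closed)
  then have "(x \<cdot> y) \<cdot> (x \<cdot> z) \<in> I"
    using X by (simp add: cycloid)
  then show ?thesis
    using ideal_mp[OF I, of "x \<cdot> y" "x \<cdot> z"] assms mult_closed by simp
qed

lemma ideal_cong_trans:
  "I \<in> ideals \<Longrightarrow> ideal_cong I x y \<Longrightarrow> ideal_cong I y z \<Longrightarrow> ideal_cong I x z"
  unfolding ideal_cong_def using ideal_mult_trans by metis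

text \<open>The second ideal axiom and the last one are exactly the two halves of this congruence:
  modulo \<open>I\<close>, members of \<open>I\<close> act from the left like the unit.\<close>

lemma ideal_cong_mult_left:
  assumes "I \<in> ideals" "a \<in> I" "x \<in> X"
  shows "ideal_cong I (a \<cdot> x) x"
  using assms
  by (auto simp: ideal_cong_def ideal_double ideal_weaken mult_closed dest: ideal_subset)

text \<open>One argument is changed at a time. For the left one, the two sides of
  \<open>cycloid\<close> reduce modulo \<open>I\<close> to \<open>x \<cdot> u\<close> and
  \<open>y \<cdot> u\<close>; for the right one, \<open>cycloid\<close> exhibits
  \<open>(y \<cdot> u) \<cdot> (y \<cdot> v)\<close> as a left multiple of
  \<open>u \<cdot> v\<close>.\<close>

lemma ideal_cong_mult:
  assumes I: "I \<in> ideals" and xy: "ideal_cong I x y" and uv: "ideal_cong I u v"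
  shows "ideal_cong I (x \<cdot> u) (y \<cdot> v)"
proof -
  have X: "x \<in> X" "y \<in> X" "u \<in> X" "v \<in> X"
    using xy uv by (auto simp: ideal_cong_def)
  have "ideal_cong I ((x \<cdot> y) \<cdot> (x \<cdot> u)) (x \<cdot> u)" "ideal_cong I ((y \<cdot> x) \<cdot> (y \<cdot> u)) (y \<cdot> u)"
    using I xy X by (simp_all add: ideal_cong_def[of I x y] ideal_cong_mult_left mult_closed)
  then have 1: "ideal_cong I (x \<cdot> u) (y \<cdot> u)"
    unfolding cycloid[OF X(1-3)] using ideal_cong_trans[OF I] ideal_cong_sym by blast
  have "(y \<cdot> u) \<cdot> (y \<cdot> v) = (u \<cdot> y) \<cdot> (u \<cdot> v)" "(y \<cdot> v) \<cdot> (y \<cdot> u) = (v \<cdot> y) \<cdot> (v \<cdot> u)"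
    by (intro cycloid X)+
  then have "ideal_cong I (y \<cdot> u) (y \<cdot> v)"
    using I uv X by (simp add: ideal_cong_def ideal_mult mult_closed)
  with I 1 show ?thesis
    by (rule ideal_cong_trans)
qed

text \<open>The witnesses are \<open>a = j \<cdot> x\<close> in one direction and
  \<open>j = a \<cdot> x\<close> in the other. The second form trades a congruence modulo
  \<open>I\<close> for a membership in \<open>J\<close>.\<close>

lemma saturation_iff:
  assumes "I \<in> ideals" "J \<in> ideals" "x \<in> X"
  shows "(\<exists>j\<in>J. ideal_cong I j x) \<longleftrightarrow> (\<exists>a\<in>I. a \<cdot> x \<in> J)"
proof
  assume "\<exists>j\<in>J. ideal_cong I j x"
  then show "\<exists>a\<in>I. a \<cdot> x \<in> J"
    using assms ideal_double by (auto simp: ideal_cong_def)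
next
  assume "\<exists>a\<in>I. a \<cdot> x \<in> J"
  then show "\<exists>j\<in>J. ideal_cong I j x"
    using assms by (blast intro: ideal_cong_mult_left)
qed

lemma saturation_in_ideals:
  assumes I: "I \<in> ideals" and J: "J \<in> ideals"
  shows "{x. \<exists>j\<in>J. ideal_cong I j x} \<in> ideals" (is "?S \<in> _")
proof -
  have mp: "y \<in> ?S" if y: "y \<in> X" and S: "x \<in> ?S" "x \<cdot> y \<in> ?S" for x y
  proof -
    obtain j k where j: "j \<in> J" "ideal_cong I j x" and k: "k \<in> J" "ideal_cong I k (x \<cdot> y)"
      using S by blast
    have jk: "j \<in> X" "k \<in> X"
      using j k J ideal_subset by auto
    have "ideal_cong I (j \<cdot> y) (x \<cdot> y)"
      by (intro ideal_cong_mult ideal_cong_refl I j(2) y)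
    then have "ideal_cong I k (j \<cdot> y)"
      using ideal_cong_trans[OF I k(2)] ideal_cong_sym by blast
    then have a: "k \<cdot> (j \<cdot> y) \<in> I"
      by (simp add: ideal_cong_def)
    \<comment> \<open>The modulus changes from \<open>I\<close> to \<open>J\<close>: since
      \<open>k\<close> and \<open>j\<close> lie in \<open>J\<close>, they can be stripped off one
      after the other.\<close>
    have "ideal_cong J (k \<cdot> (j \<cdot> y)) y"
      by (rule ideal_cong_trans[OF J ideal_cong_mult_left ideal_cong_mult_left])
        (use J j(1) k(1) jk y mult_closed in auto)
    then have "(k \<cdot> (j \<cdot> y)) \<cdot> y \<in> J"
      by (simp add: ideal_cong_def)
    then show ?thesis
      using a saturation_iff[OF I J y] by blast
  qed
  have "(x \<cdot> y) \<cdot> y \<in> ?S \<and> y \<cdot> x \<in> ?S \<and> y \<cdot> (x \<cdot> y) \<in> ?S" if y: "y \<in> X" and S: "x \<in> ?S" for x y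
  proof -
    obtain j where j: "j \<in> J" "ideal_cong I j x"
      using S by blast
    have yy: "ideal_cong I y y"
      using I y by (rule ideal_cong_refl)
    \<comment> \<open>Replacing \<open>x\<close> by \<open>j\<close> keeps each term in its class
      modulo \<open>I\<close>, and the terms in \<open>j\<close> lie in the ideal
      \<open>J\<close>.\<close>
    have "ideal_cong I ((j \<cdot> y) \<cdot> y) ((x \<cdot> y) \<cdot> y)" "ideal_cong I (y \<cdot> j) (y \<cdot> x)"
      "ideal_cong I (y \<cdot> (j \<cdot> y)) (y \<cdot> (x \<cdot> y))"
      by (intro ideal_cong_mult I j yy)+
    then show ?thesis
      using ideal_double[OF J j(1) y] ideal_mult[OF J j(1) y]
        ideal_weaken[OF J j(1) y] by blast
  qed
  moreover have "?S \<subseteq> X" "\<one> \<in> ?S"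
    using I J ideal_unit unit_closed by (auto simp: ideal_cong_def mult_self)
  ultimately show ?thesis
    using mp by (intro idealsI)
qed

lemma ideal_join_eq_saturation:
  assumes I: "I \<in> ideals" and J: "J \<in> ideals"
  shows "ideal_join I J = {x. \<exists>j\<in>J. ideal_cong I j x}" (is "_ = ?S")
proof
  have "I \<subseteq> ?S"
  proof
    fix x assume x: "x \<in> I"
    then have "x \<in> X"
      using I ideal_subset by blast
    \<comment> \<open>All of \<open>I\<close> is congruent to the unit, which belongs to
      \<open>J\<close>.\<close>
    then have "ideal_cong I \<one> x"
      using x I by (simp add: ideal_cong_def unit_closed mult_unit unit_mult ideal_unit)
    then show "x \<in> ?S"
      using J ideal_unit by blast
  qed
  moreover have "J \<subseteq> ?S"
    using I J ideal_cong_refl ideal_subset by blast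
  ultimately show "ideal_join I J \<subseteq> ?S"
    using I J by (intro ideal_join_least saturation_in_ideals) auto
  show "?S \<subseteq> ideal_join I J"
    using ideal_join_least(2)[OF I J] ideal_mp[OF ideal_join_least(1)[OF I J]]
    by (auto simp: ideal_cong_def)
qed

lemma Int_in_ideals: "I \<in> ideals \<Longrightarrow> J \<in> ideals \<Longrightarrow> I \<inter> J \<in> ideals"
  using Inter_in_ideals[of "{I, J}"] by simp

lemma ideal_join_Int_distrib:
  assumes I: "I \<in> ideals" and J: "J \<in> ideals" and K: "K \<in> ideals"
  shows "ideal_join I J \<inter> K = ideal_join (I \<inter> K) (J \<inter> K)"
proof
  note L = ideal_join_least[OF Int_in_ideals[OF I K] Int_in_ideals[OF J K]]
  show "ideal_join I J \<inter> K \<subseteq> ideal_join (I \<inter> K) (J \<inter> K)"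
  proof
    fix x assume x: "x \<in> ideal_join I J \<inter> K"
    then obtain j where j: "j \<in> J" "ideal_cong I j x"
      using ideal_join_eq_saturation[OF I J] by blast
    then have X: "j \<in> X" "x \<in> X" and jx: "j \<cdot> x \<in> I"
      by (auto simp: ideal_cong_def)
    \<comment> \<open>Membership in \<open>K\<close> comes from left absorption:
      \<open>j \<cdot> x\<close> and \<open>(j \<cdot> x) \<cdot> x\<close> are both left multiples
      of \<open>x\<close>.\<close>
    have "j \<cdot> x \<in> I \<inter> K"
      using jx x X K by (auto intro: ideal_mult)
    moreover have "(j \<cdot> x) \<cdot> x \<in> J \<inter> K"
      using j(1) x X J K by (auto intro: ideal_double ideal_mult mult_closed)
    ultimately show "x \<in> ideal_join (I \<inter> K) (J \<inter> K)"
      using L(2) ideal_mp[OF L(1) _ X(2), of "j \<cdot> x"] by blast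
  qed
  show "ideal_join (I \<inter> K) (J \<inter> K) \<subseteq> ideal_join I J \<inter> K"
    using ideal_join_least(1,2)[OF I J] K by (intro L(3) Int_in_ideals) auto
qed

end

theorem theorem4:
  fixes X :: "'a set" and mult :: "'a \<Rightarrow> 'a \<Rightarrow> 'a" and unit :: 'a
  assumes "L_algebra X mult unit"
    and "I \<in> L_algebra.ideals X mult unit"
    and "J \<in> L_algebra.ideals X mult unit"
    and "K \<in> L_algebra.ideals X mult unit"
  shows "L_algebra.ideal_join X mult unit I J \<inter> K =
    L_algebra.ideal_join X mult unit (I \<inter> K) (J \<inter> K)"
  using assms by (rule L_algebra.ideal_join_Int_distrib)

end
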